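(* Consider Gaussian MAB satisfying Assumption 1 with proportion $q$ of inferior arms, inferior arms being distributed as $\mathcal N(0,1)$ and superior arms as $\mathcal N(\mu,1)$ with $\mu>0$. Let $f_0,f_1$ be the densities of $\mathcal N(0,1)$ and $\mathcal N(\mu,1)$, and let $$G(q,\mu)=\max\left\{\int|qf_0(x)-(1-q)f_1(x)|\,dx,\ \int|(1-q)f_0(x)-qf_1(x)|\,dx\right\}.$$ For any $q\ge1/3$, if $\mu$ satisfies $G(q,\mu)<q$, and $\epsilon$ and $T$ satisfy $$G(q,\mu)<\epsilon<q,\qquad T\le\frac{\epsilon-G(q,\mu)}{(1-q)\int|f_0(x)-f_1(x)|\,dx}+2,$$ then $$R_L(T)\ge(q-\epsilon)\cdot\mu\cdot T.$$
   Context: MAB: at each step $t=1,\dots,T$ the player pulls one of $K$ arms and receives the reward $y_t$ of that arm; rewards of arms are independent over time. Pseudo regret: $R'_T=T\max_k\mu_k-\sum_{t=1}^TE[y_t]$, with $\mu_k$ the mean of arm $k$. Assumption 1: There are two types of arms, superior (set $S$) and inferior (set $I$), in proportions $1-q$ and $q$ respectively ($0\le q\le1$), the proportions being known to the adversary. Arms within $S$ are indistinguishable (identically distributed), and so are those within $I$. The first pull has two steps: first the player selects a set with $P(S)=1-q$, $P(I)=q$, and then the reward of an arm from the selected set is received. (The player is not told which set was selected; a strategy decides at each later step $i>1$, as a function of the rewards $y_1,\dots,y_{i-1}$, whether to pull from the same set as the first pull or from the other set.) $R_L(T)=\inf\sup R'_T$, where the infimum is over all strategies and the supremum is over all Gaussian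 MAB. *)

theory Defs
  imports "HOL-Probability.Probability"
begin

datatype arm_type = Inferior | Superior

fun other_type :: "arm_type \<Rightarrow> arm_type" where
  "other_type Inferior = Superior"
| "other_type Superior = Inferior"

text \<open>
  Arms of the same type are identically distributed and a strategy only chooses between the
  two sets of arms, so an instance is given by the proportion of inferior arms and the mean
  and standard deviation of the reward of each type. The proportion may be any real in [0, 1].
\<close>

record mab =
  inferior_prop :: real
  arm_mean :: "arm_type \<Rightarrow> real"
  arm_sd :: "arm_type \<Rightarrow> real"

definition gaussian_mab :: "mab \<Rightarrow> bool" where
  "gaussian_mab m \<longleftrightarrow>
     0 \<le> inferior_prop m \<and> inferior_prop m \<le> 1 \<and>
     arm_mean m Inferior < arm_mean m Superior \<and> (\<forall>\<tau>. 0 < arm_sd m \<tau>)"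

definition first_set :: "mab \<Rightarrow> arm_type pmf" where
  "first_set m =
     map_pmf (\<lambda>b. if b then Inferior else Superior) (bernoulli_pmf (inferior_prop m))"

text \<open>
  Only types present with positive proportion count, so for proportion 1 of inferior arms
  the best mean is the inferior one.
\<close>

definition best_mean :: "mab \<Rightarrow> real" where
  "best_mean m = Max (arm_mean m ` set_pmf (first_set m))"

definition reward_dist :: "mab \<Rightarrow> arm_type \<Rightarrow> real measure" where
  "reward_dist m \<tau> = density lborel (\<lambda>x. ennreal (normal_density (arm_mean m \<tau>) (arm_sd m \<tau>) x))"

text \<open>
  An outcome is the set drawn at the first pull together with an independent table of rewards:
  entry \<open>(t, \<tau>)\<close> is the reward received at step \<open>t\<close> if an arm of type \<open>\<tau>\<close> is pulled.
\<close>

definition outcome_space :: "mab \<Rightarrow> (arm_type \<times> (nat \<times> arm_type \<Rightarrow> real)) measure" where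
  "outcome_space m =
     measure_pmf (first_set m) \<Otimes>\<^sub>M PiM UNIV (\<lambda>(t, \<tau>). reward_dist m \<tau>)"

text \<open>
  For \<open>i > 1\<close>, \<open>\<pi> i h\<close> states that step \<open>i\<close> pulls from the same set as the first pull, where
  \<open>h\<close> holds the rewards of steps \<open>1, \<dots>, i - 1\<close> and is undefined elsewhere.
\<close>

type_synonym strategy = "nat \<Rightarrow> (nat \<Rightarrow> real) \<Rightarrow> bool"

definition strategies :: "strategy set" where
  "strategies = {\<pi>. \<forall>i>1. \<pi> i \<in> PiM {1..<i} (\<lambda>_. borel) \<rightarrow>\<^sub>M count_space UNIV}"

definition pulled_type :: "strategy \<Rightarrow> arm_type \<Rightarrow> nat \<Rightarrow> (nat \<Rightarrow> real) \<Rightarrow> arm_type" where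
  "pulled_type \<pi> a i h = (if i = 1 \<or> \<pi> i h then a else other_type a)"

primrec history ::
  "strategy \<Rightarrow> arm_type \<times> (nat \<times> arm_type \<Rightarrow> real) \<Rightarrow> nat \<Rightarrow> nat \<Rightarrow> real" where
  "history \<pi> \<omega> 0 = (\<lambda>_. undefined)"
| "history \<pi> \<omega> (Suc n) =
     (history \<pi> \<omega> n)(Suc n := snd \<omega> (Suc n, pulled_type \<pi> (fst \<omega>) (Suc n) (history \<pi> \<omega> n)))"

definition reward :: "strategy \<Rightarrow> nat \<Rightarrow> arm_type \<times> (nat \<times> arm_type \<Rightarrow> real) \<Rightarrow> real" where
  "reward \<pi> t \<omega> = history \<pi> \<omega> t t"

definition pseudo_regret :: "mab \<Rightarrow> strategy \<Rightarrow> nat \<Rightarrow> real" where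
  "pseudo_regret m \<pi> T =
     real T * best_mean m - (\<Sum>t=1..T. \<integral>\<omega>. reward \<pi> t \<omega> \<partial>outcome_space m)"

text \<open>
  The class \<open>M\<close> of instances is a parameter. Taken over all Gaussian instances with unbounded
  gap between the means, the supremum is infinite; taken over a single instance, it is the
  regret on that instance.
\<close>

definition R_L :: "mab set \<Rightarrow> nat \<Rightarrow> ereal" where
  "R_L M T = (INF \<pi>\<in>strategies. SUP m\<in>M. ereal (pseudo_regret m \<pi> T))"

definition unit_gaussian_mab :: "real \<Rightarrow> real \<Rightarrow> mab" where
  "unit_gaussian_mab q \<mu> =
     \<lparr>inferior_prop = q,
      arm_mean = (\<lambda>\<tau>. case \<tau> of Inferior \<Rightarrow> 0 | Superior \<Rightarrow> \<mu>),
      arm_sd = (\<lambda>_. 1)\<rparr>"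

definition G :: "real \<Rightarrow> real \<Rightarrow> real" where
  "G q \<mu> = max
     (\<integral>x. \<bar>q * normal_density 0 1 x - (1 - q) * normal_density \<mu> 1 x\<bar> \<partial>lborel)
     (\<integral>x. \<bar>(1 - q) * normal_density 0 1 x - q * normal_density \<mu> 1 x\<bar> \<partial>lborel)"

end

theory Submission
  imports Defs
begin

text \<open>
  At each step the expected shortfall is \<open>\<mu>\<close> times the probability of pulling an inferior arm,
  so the player is testing, from the past rewards, which set the first pull came from. The
  two conditional laws of the rewards, weighted by \<open>q\<close> and \<open>1 - q\<close>, are at distance at most
  \<open>G q \<mu>\<close> after the first reward. Whatever the strategy does later, knowing the first set and
  the history tells which density the next reward has, and the two hypotheses use
  \<open>f\<^sub>0\<close> and \<open>f\<^sub>1\<close> in opposite roles; hence each further reward adds at most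
  \<open>(1 - q) * \<integral>\<bar>f\<^sub>0 - f\<^sub>1\<bar>\<close>. The bound on \<open>T\<close> keeps this distance below \<open>\<epsilon>\<close>, so the
  probability of error at each step \<open>t > 1\<close> is at least \<open>(1 - \<epsilon>) / 2\<close>. This is at least \<open>q - \<epsilon>\<close>
  because \<open>2 * q - 1 \<le> G q \<mu> < \<epsilon>\<close>.
\<close>

section \<open>Countability and independence preliminaries\<close>

instance arm_type :: countable
  by countable_datatype

lemma UNIV_arm_type: "UNIV = {Inferior, Superior}"
  using arm_type.exhaust by auto

text \<open>Independence means that the joint law is the product of the marginal laws. Here the
  joint law is the image of the product measure under the identity.\<close>

lemma indep_vars_PiM_components:
  assumes "\<And>i. prob_space (M' i)" and "I \<noteq> {}"
  shows "prob_space.indep_vars (PiM I M') M' (\<lambda>i \<omega>. \<omega> i) I"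
proof -
  interpret P: prob_space "PiM I M'"
    by (rule prob_space_PiM) (rule assms)
  have "distr (PiM I M') (PiM I M') (\<lambda>x. \<lambda>i\<in>I. x i) = distr (PiM I M') (PiM I M') (\<lambda>x. x)"
    by (intro distr_cong) (auto simp: space_PiM)
  also have "\<dots> = (\<Pi>\<^sub>M i\<in>I. distr (PiM I M') (M' i) (\<lambda>x. x i))"
    by (simp add: distr_PiM_component assms cong: PiM_cong)
  finally show ?thesis
    by (subst P.indep_vars_iff_distr_eq_PiM') (use assms in auto)
qed

text \<open>Keeps the simplifier from turning the index sets \<open>{1..n}\<close> of product spaces into \<open>{Suc 0..n}\<close>.\<close>

declare One_nat_def [simp del]

section \<open>Histories generated by a fixed strategy and two arbitrary reward laws\<close>

locale two_type_bandit =
  fixes N :: "arm_type \<Rightarrow> real measure" and \<pi> :: strategy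
  assumes prob_space_N: "prob_space (N \<tau>)"
    and sets_N [simp, measurable_cong]: "sets (N \<tau>) = sets borel"
    and strategy: "\<pi> \<in> strategies"
begin

abbreviation table :: "(nat \<times> arm_type \<Rightarrow> real) measure" where
  "table \<equiv> PiM UNIV (\<lambda>(t, \<tau>). N \<tau>)"

abbreviation histories :: "nat \<Rightarrow> (nat \<Rightarrow> real) measure" where
  "histories n \<equiv> PiM {1..n} (\<lambda>_. borel)"

text \<open>The law of the first \<open>n\<close> rewards given that the first pull is from set
  \<open>a\<close>. Inferring the first set means distinguishing \<open>H Inferior n\<close> from
  \<open>H Superior n\<close>.\<close>

definition H :: "arm_type \<Rightarrow> nat \<Rightarrow> (nat \<Rightarrow> real) measure" where
  "H a n = distr table (histories n) (\<lambda>\<omega>. history \<pi> (a, \<omega>) n)"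

sublocale P: prob_space table
  by (rule prob_space_PiM) (auto simp: prob_space_N split: prod.split)

lemma space_N [simp]: "space (N \<tau>) = UNIV"
  using sets_eq_imp_space_eq[OF sets_N] by simp

lemma sets_H [simp, measurable_cong]: "sets (H a n) = sets (histories n)"
  by (simp add: H_def)

lemma measurable_strategy:
  "n \<ge> 1 \<Longrightarrow> \<pi> (Suc n) \<in> histories n \<rightarrow>\<^sub>M count_space UNIV"
  using strategy unfolding strategies_def
  by (auto dest!: spec[of _ "Suc n"] simp: atLeastLessThanSuc_atLeastAtMost)

lemma measurable_pulled_type [measurable]:
  "pulled_type \<pi> a (Suc n) \<in> histories n \<rightarrow>\<^sub>M count_space UNIV"
\<comment> \<open>Nothing is assumed about \<open>\<pi> 1\<close>, so the first pull, which ignores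
  the strategy, is treated apart.\<close>
proof (cases "n = 0")
  case True
  then show ?thesis by (simp add: pulled_type_def[abs_def])
next
  case False
  then have [measurable]: "\<pi> (Suc n) \<in> histories n \<rightarrow>\<^sub>M count_space UNIV"
    by (intro measurable_strategy) simp
  have "(\<lambda>h. if \<pi> (Suc n) h then a else other_type a) \<in> histories n \<rightarrow>\<^sub>M count_space UNIV"
    by measurable
  then show ?thesis
    using False by (simp add: pulled_type_def[abs_def])
qed

text \<open>Makes the history a function of the table rows up to \<open>n\<close> alone, hence
  independent of row \<open>Suc n\<close>.\<close>

lemma history_cong:
  assumes "\<And>t \<tau>. t \<in> {1..n} \<Longrightarrow> \<omega> (t, \<tau>) = \<omega>' (t, \<tau>)"
  shows "history \<pi> (a, \<omega>) n = history \<pi> (a, \<omega>') n"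
  using assms by (induction n) (auto simp: le_SucI)

text \<open>The index set \<open>K\<close> is kept general because both the full table and its first
  \<open>n\<close> rows occur below.\<close>

lemma measurable_history:
  assumes "{1..n} \<times> UNIV \<subseteq> K"
  shows "(\<lambda>\<omega>. history \<pi> (a, \<omega>) n) \<in> PiM K (\<lambda>(t, \<tau>). N \<tau>) \<rightarrow>\<^sub>M histories n"
  using assms
proof (induction n)
  case 0
  show ?case by (simp add: space_PiM)
next
  case (Suc n)
  let ?K = "PiM K (\<lambda>(t, \<tau>). N \<tau>)"
  have [measurable]: "(\<lambda>\<omega>. history \<pi> (a, \<omega>) n) \<in> ?K \<rightarrow>\<^sub>M histories n"
    using Suc by (intro Suc.IH) force
  have [measurable]: "(\<lambda>\<omega>. \<omega> (Suc n, \<tau>)) \<in> ?K \<rightarrow>\<^sub>M borel" for \<tau>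
  proof -
    have "(Suc n, \<tau>) \<in> K"
      using Suc.prems by force
    then show ?thesis
      using measurable_component_singleton[of "(Suc n, \<tau>)" K "\<lambda>(t, \<tau>). N \<tau>"]
      by (simp cong: measurable_cong_sets)
  qed
  \<comment> \<open>The entry being read depends on the history. A case split over the two types
    leaves only fixed coordinates.\<close>
  have "(\<lambda>\<omega>. if pulled_type \<pi> a (Suc n) (history \<pi> (a, \<omega>) n) = Inferior
              then \<omega> (Suc n, Inferior) else \<omega> (Suc n, Superior)) \<in> borel_measurable ?K"
    by measurable
  also have "(\<lambda>\<omega>. if pulled_type \<pi> a (Suc n) (history \<pi> (a, \<omega>) n) = Inferior
              then \<omega> (Suc n, Inferior) else \<omega> (Suc n, Superior)) =
             (\<lambda>\<omega>. \<omega> (Suc n, pulled_type \<pi> a (Suc n) (history \<pi> (a, \<omega>) n)))"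
    by (auto simp: fun_eq_iff) (metis arm_type.exhaust)
  finally show ?case
    by (simp del: fun_upd_apply) (rule measurable_fun_upd[where J = "{1..n}"], auto)
qed

lemma measurable_history_table [measurable]:
  "(\<lambda>\<omega>. history \<pi> (a, \<omega>) n) \<in> table \<rightarrow>\<^sub>M histories n"
  by (rule measurable_history) simp

lemma measurable_table_component [measurable]:
  "(\<lambda>\<omega>. \<omega> (t, \<tau>)) \<in> table \<rightarrow>\<^sub>M borel"
  using measurable_component_singleton[of "(t, \<tau>)" UNIV "\<lambda>(t, \<tau>). N \<tau>"]
  by (auto cong: measurable_cong_sets)

lemma prob_space_H: "prob_space (H a n)"
  unfolding H_def by (rule P.prob_space_distr) (rule measurable_history_table)

section \<open>Law of the next reward given the history\<close>

lemma distr_table_component: "distr table borel (\<lambda>\<omega>. \<omega> (t, \<tau>)) = N \<tau>"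
proof -
  have "distr table borel (\<lambda>\<omega>. \<omega> (t, \<tau>)) = distr table (N \<tau>) (\<lambda>\<omega>. \<omega> (t, \<tau>))"
    by (intro distr_cong) auto
  also have "\<dots> = N \<tau>"
    using distr_PiM_component[of UNIV "\<lambda>(t, \<tau>). N \<tau>" "(t, \<tau>)"]
    by (auto simp: prob_space_N)
  finally show ?thesis .
qed

text \<open>The history uses rows \<open>1\<close> to \<open>n\<close> of the table and the next
  entry lies in row \<open>Suc n\<close>, so the two are independent. The type \<open>\<tau>\<close>
  is fixed here; a type chosen from the history would not give a product law.\<close>

lemma distr_history_next:
  "distr table (histories n \<Otimes>\<^sub>M borel) (\<lambda>\<omega>. (history \<pi> (a, \<omega>) n, \<omega> (Suc n, \<tau>))) =
     H a n \<Otimes>\<^sub>M N \<tau>"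
proof -
  let ?N = "\<lambda>(t, \<tau>). N \<tau> :: real measure"
  let ?A = "{1..n} \<times> (UNIV :: arm_type set)" and ?B = "{Suc n} \<times> (UNIV :: arm_type set)"
  have "P.indep_vars ?N (\<lambda>i \<omega>. \<omega> i) UNIV"
    by (rule indep_vars_PiM_components) (auto simp: prob_space_N)
  then have indep: "P.indep_var (PiM ?A ?N) (\<lambda>\<omega>. restrict (\<lambda>i. \<omega> i) ?A) (PiM ?B ?N) (\<lambda>\<omega>. restrict (\<lambda>i. \<omega> i) ?B)"
    by (rule P.indep_var_restrict) auto
  have component: "(\<lambda>\<omega>. \<omega> (Suc n, \<tau>)) \<in> PiM ?B ?N \<rightarrow>\<^sub>M borel"
    using measurable_component_singleton[of "(Suc n, \<tau>)" ?B ?N]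
    by (auto cong: measurable_cong_sets)
  have history: "(\<lambda>\<omega>. history \<pi> (a, \<omega>) n) \<in> PiM ?A ?N \<rightarrow>\<^sub>M histories n"
    by (rule measurable_history) simp
  let ?DA = "distr table (PiM ?A ?N) (\<lambda>\<omega>. restrict \<omega> ?A)"
  let ?DB = "distr table (PiM ?B ?N) (\<lambda>\<omega>. restrict \<omega> ?B)"
  let ?f = "\<lambda>\<omega>. history \<pi> (a, \<omega>) n" and ?g = "\<lambda>\<omega>. \<omega> (Suc n, \<tau>)"
  have restrict: "(\<lambda>\<omega>. restrict \<omega> L) \<in> table \<rightarrow>\<^sub>M PiM L ?N" for L
    by (rule measurable_restrict_subset) simp
  have f_restrict: "?f (restrict \<omega> ?A) = ?f \<omega>" for \<omega>
    by (rule history_cong) simp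
  have DA: "distr ?DA (histories n) ?f = H a n"
    unfolding H_def distr_distr[OF history restrict] comp_def f_restrict ..
  have DB: "distr ?DB borel ?g = N \<tau>"
    unfolding distr_distr[OF component restrict] comp_def
    by (simp add: distr_table_component)
  have "H a n \<Otimes>\<^sub>M N \<tau> = distr (?DA \<Otimes>\<^sub>M ?DB) (histories n \<Otimes>\<^sub>M borel) (\<lambda>(x, y). (?f x, ?g y))"
    unfolding DA[symmetric] DB[symmetric]
    by (rule pair_measure_distr)
       (use history component in \<open>simp_all add: DB prob_space_N prob_space_imp_sigma_finite\<close>)
  also have "?DA \<Otimes>\<^sub>M ?DB = distr table (PiM ?A ?N \<Otimes>\<^sub>M PiM ?B ?N) (\<lambda>\<omega>. (restrict \<omega> ?A, restrict \<omega> ?B))"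
    using indep by (simp add: P.indep_var_distribution_eq)
  also have "distr \<dots> (histories n \<Otimes>\<^sub>M borel) (\<lambda>(x, y). (?f x, ?g y)) =
      distr table (histories n \<Otimes>\<^sub>M borel) (\<lambda>\<omega>. (?f \<omega>, ?g \<omega>))"
    using history component restrict
    by (subst distr_distr) (simp_all add: comp_def f_restrict measurable_split_conv)
  finally show ?thesis ..
qed

text \<open>The pulled type is a function of the history. Splitting by its value reduces each piece
  \<open>?F \<tau>\<close> to a fixed type, where the product law and Fubini apply.\<close>

lemma integral_history_next:
  fixes F :: "(nat \<Rightarrow> real) \<times> real \<Rightarrow> real"
  assumes "\<And>\<tau>. integrable (H a n \<Otimes>\<^sub>M N \<tau>) F"
  shows "(\<integral>\<omega>. F (history \<pi> (a, \<omega>) n, \<omega> (Suc n, pulled_type \<pi> a (Suc n) (history \<pi> (a, \<omega>) n))) \<partial>table) =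
         (\<integral>x. (\<integral>y. F (x, y) \<partial>N (pulled_type \<pi> a (Suc n) x)) \<partial>H a n)"
proof -
  let ?p = "pulled_type \<pi> a (Suc n)"
  let ?F = "\<lambda>\<tau> (x, y). indicator {x. ?p x = \<tau>} x * F (x, y)"
  have F [measurable]: "F \<in> borel_measurable (histories n \<Otimes>\<^sub>M borel)"
    using borel_measurable_integrable[OF assms[of Inferior]]
    by (auto cong: measurable_cong_sets sets_pair_measure_cong)
  have F' [measurable]: "?F \<tau> \<in> borel_measurable (histories n \<Otimes>\<^sub>M borel)" for \<tau>
    unfolding indicator_def by measurable
  have int: "integrable (H a n \<Otimes>\<^sub>M N \<tau>) (?F \<tau>')" for \<tau> \<tau>'
    using F'[of \<tau>']
    by (intro Bochner_Integration.integrable_bound[OF assms[of \<tau>]])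
       (auto split: split_indicator cong: measurable_cong_sets sets_pair_measure_cong)
  have eq: "(\<integral>\<omega>. ?F \<tau> (history \<pi> (a, \<omega>) n, \<omega> (Suc n, \<tau>)) \<partial>table) =
      (\<integral>x. (\<integral>y. ?F \<tau> (x, y) \<partial>N \<tau>) \<partial>H a n)"
    and int1: "integrable table (\<lambda>\<omega>. ?F \<tau> (history \<pi> (a, \<omega>) n, \<omega> (Suc n, \<tau>)))"
    and int2: "integrable (H a n) (\<lambda>x. \<integral>y. ?F \<tau> (x, y) \<partial>N \<tau>)" for \<tau>
  proof -
    interpret HN: pair_prob_space "H a n" "N \<tau>"
      by (simp add: pair_prob_space_def pair_sigma_finite_def prob_space_H prob_space_N prob_space_imp_sigma_finite)
    show "integrable (H a n) (\<lambda>x. \<integral>y. ?F \<tau> (x, y) \<partial>N \<tau>)"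
      by (rule HN.integrable_fst'[OF int])
    show "integrable table (\<lambda>\<omega>. ?F \<tau> (history \<pi> (a, \<omega>) n, \<omega> (Suc n, \<tau>)))"
      using int[of \<tau> \<tau>] F'[of \<tau>] unfolding distr_history_next[symmetric]
      by (subst (asm) integrable_distr_eq) auto
    have "(\<integral>x. (\<integral>y. ?F \<tau> (x, y) \<partial>N \<tau>) \<partial>H a n) = (\<integral>z. ?F \<tau> z \<partial>(H a n \<Otimes>\<^sub>M N \<tau>))"
      by (rule HN.integral_fst'[OF int])
    also have "\<dots> = (\<integral>\<omega>. ?F \<tau> (history \<pi> (a, \<omega>) n, \<omega> (Suc n, \<tau>)) \<partial>table)"
      unfolding distr_history_next[symmetric] using F'[of \<tau>]
      by (subst integral_distr) auto
    finally show "(\<integral>\<omega>. ?F \<tau> (history \<pi> (a, \<omega>) n, \<omega> (Suc n, \<tau>)) \<partial>table) =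
      (\<integral>x. (\<integral>y. ?F \<tau> (x, y) \<partial>N \<tau>) \<partial>H a n)" ..
  qed
  have split: "f (?p x) = indicator {x. ?p x = Inferior} x * f Inferior + indicator {x. ?p x = Superior} x * (f Superior :: real)" for f x
    by (cases "?p x") auto
  have "(\<integral>\<omega>. F (history \<pi> (a, \<omega>) n, \<omega> (Suc n, ?p (history \<pi> (a, \<omega>) n))) \<partial>table) =
    (\<integral>\<omega>. ?F Inferior (history \<pi> (a, \<omega>) n, \<omega> (Suc n, Inferior)) + ?F Superior (history \<pi> (a, \<omega>) n, \<omega> (Suc n, Superior)) \<partial>table)"
    by (intro Bochner_Integration.integral_cong refl)
       (subst split[of "\<lambda>\<tau>. F (_, _ (Suc n, \<tau>))"], simp)
  also have "\<dots> = (\<integral>x. (\<integral>y. ?F Inferior (x, y) \<partial>N Inferior) + (\<integral>y. ?F Superior (x, y) \<partial>N Superior) \<partial>H a n)"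
    using int1 int2 by (simp only: Bochner_Integration.integral_add eq)
  also have "\<dots> = (\<integral>x. (\<integral>y. F (x, y) \<partial>N (?p x)) \<partial>H a n)"
    by (intro Bochner_Integration.integral_cong refl)
       (subst split[of "\<lambda>\<tau>. integral\<^sup>L (N \<tau>) _"], simp)
  finally show ?thesis .
qed

text \<open>The one-step recursion for \<open>H\<close>: given the history, the next reward has the
  law of the pulled type. Boundedness of \<open>h\<close> supplies integrability.\<close>

lemma integral_H_Suc:
  fixes h :: "(nat \<Rightarrow> real) \<Rightarrow> real"
  assumes h [measurable]: "h \<in> borel_measurable (histories (Suc n))"
    and bound: "\<And>x. x \<in> space (histories (Suc n)) \<Longrightarrow> \<bar>h x\<bar> \<le> B"
  shows "(\<integral>x. h x \<partial>H a (Suc n)) =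
         (\<integral>x. (\<integral>y. h (x(Suc n := y)) \<partial>N (pulled_type \<pi> a (Suc n) x)) \<partial>H a n)"
proof -
  let ?F = "\<lambda>(x, y). h (x(Suc n := y))"
  have upd [measurable]: "(\<lambda>(x, y). x(Suc n := y)) \<in> histories n \<Otimes>\<^sub>M borel \<rightarrow>\<^sub>M histories (Suc n)"
    unfolding split_beta by (rule measurable_fun_upd[where J = "{1..n}"]) auto
  have F: "?F \<in> borel_measurable (histories n \<Otimes>\<^sub>M borel)"
    using measurable_compose[OF upd h] by (simp add: split_beta)
  have int: "integrable (H a n \<Otimes>\<^sub>M N \<tau>) ?F" for \<tau>
  proof -
    interpret HN: pair_prob_space "H a n" "N \<tau>"
      by (simp add: pair_prob_space_def pair_sigma_finite_def prob_space_H prob_space_N prob_space_imp_sigma_finite)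
    have sets: "sets (H a n \<Otimes>\<^sub>M N \<tau>) = sets (histories n \<Otimes>\<^sub>M borel)"
      by (intro sets_pair_measure_cong) auto
    have "\<bar>?F z\<bar> \<le> B" if "z \<in> space (H a n \<Otimes>\<^sub>M N \<tau>)" for z
      using bound[OF measurable_space[OF upd, of z]] that
      by (simp add: sets_eq_imp_space_eq[OF sets] split_beta)
    moreover have "?F \<in> borel_measurable (H a n \<Otimes>\<^sub>M N \<tau>)"
      using F by (simp cong: measurable_cong_sets add: sets)
    ultimately show ?thesis
      by (intro HN.integrable_const_bound[where B = B] AE_I2) auto
  qed
  have "(\<integral>x. h x \<partial>H a (Suc n)) = (\<integral>\<omega>. h (history \<pi> (a, \<omega>) (Suc n)) \<partial>table)"
    unfolding H_def by (rule integral_distr[OF measurable_history_table h])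
  then show ?thesis
    using integral_history_next[of a n ?F, OF int] by simp
qed

lemma integrable_table_component:
  assumes "integrable (N \<tau>) (\<lambda>y. y)"
  shows "integrable table (\<lambda>\<omega>. \<omega> (t, \<tau>))"
  using assms unfolding distr_table_component[of t \<tau>, symmetric]
  by (subst (asm) integrable_distr_eq) auto

text \<open>The case \<open>F = snd\<close> of \<open>integral_history_next\<close>. The identity
  need not be bounded, which is why that lemma asks for integrability instead.\<close>

lemma integral_reward:
  assumes "\<And>\<tau>. integrable (N \<tau>) (\<lambda>y. y)"
  shows "(\<integral>\<omega>. reward \<pi> (Suc n) (a, \<omega>) \<partial>table) =
         (\<integral>x. (\<integral>y. y \<partial>N (pulled_type \<pi> a (Suc n) x)) \<partial>H a n)"
proof -
  have "integrable (H a n \<Otimes>\<^sub>M N \<tau>) snd" for \<tau>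
    unfolding distr_history_next[symmetric]
    by (subst integrable_distr_eq) (auto intro: integrable_table_component assms)
  from integral_history_next[OF this] show ?thesis
    by (simp add: reward_def)
qed

section \<open>Testing the first set from the rewards\<close>

text \<open>A test \<open>h\<close> with values in \<open>[-1, 1]\<close> separates the weighted
  laws by at most \<open>V\<close> after one reward, and every further reward adds at most
  \<open>(1 - q) * \<Delta>\<close>. Induction on the number of further rewards, integrating out the
  last one.\<close>

lemma history_test_bound:
  fixes h :: "(nat \<Rightarrow> real) \<Rightarrow> real"
  assumes q: "q \<le> 1"
    and first: "\<And>g :: real \<Rightarrow> real. g \<in> borel_measurable borel \<Longrightarrow> (\<And>y. \<bar>g y\<bar> \<le> 1) \<Longrightarrow>
      q * (\<integral>y. g y \<partial>N Inferior) - (1 - q) * (\<integral>y. g y \<partial>N Superior) \<le> V"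
    and gap: "\<And>g :: real \<Rightarrow> real. g \<in> borel_measurable borel \<Longrightarrow> (\<And>y. \<bar>g y\<bar> \<le> 1) \<Longrightarrow>
      \<bar>(\<integral>y. g y \<partial>N Inferior) - (\<integral>y. g y \<partial>N Superior)\<bar> \<le> \<Delta>"
    and "h \<in> borel_measurable (histories (Suc n))"
    and "\<And>x. x \<in> space (histories (Suc n)) \<Longrightarrow> \<bar>h x\<bar> \<le> 1"
  shows "q * (\<integral>x. h x \<partial>H Inferior (Suc n)) - (1 - q) * (\<integral>x. h x \<partial>H Superior (Suc n))
         \<le> V + real n * ((1 - q) * \<Delta>)"
  using assms(4,5)
proof (induction n arbitrary: h)
  case 0
  note [measurable] = 0(1)
  \<comment> \<open>The only point of the space of empty histories, so \<open>H a 0\<close> is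
    concentrated there.\<close>
  let ?u = "(\<lambda>_. undefined) :: nat \<Rightarrow> real"
  have upd [measurable]: "(\<lambda>y. ?u(Suc 0 := y)) \<in> borel \<rightarrow>\<^sub>M histories (Suc 0)"
    by (rule measurable_fun_upd[where J = "{}"]) (auto simp: space_PiM)
  have "(\<integral>x. h x \<partial>H a (Suc 0)) = (\<integral>y. h (?u(Suc 0 := y)) \<partial>N a)" for a
  proof -
    interpret H: prob_space "H a 0"
      by (rule prob_space_H)
    have "(\<integral>x. h x \<partial>H a (Suc 0)) =
          (\<integral>x. (\<integral>y. h (x(Suc 0 := y)) \<partial>N (pulled_type \<pi> a (Suc 0) x)) \<partial>H a 0)"
      using 0 by (rule integral_H_Suc)
    also have "\<dots> = (\<integral>x. (\<integral>y. h (?u(Suc 0 := y)) \<partial>N a) \<partial>H a 0)"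
      by (intro Bochner_Integration.integral_cong refl)
         (auto simp: H_def space_PiM pulled_type_def One_nat_def)
    finally show ?thesis
      by (simp add: H.prob_space)
  qed
  moreover have "\<bar>h (?u(Suc 0 := y))\<bar> \<le> 1" for y
    using measurable_space[OF upd, of y] by (intro 0) (simp del: fun_upd_apply)
  ultimately show ?case
    using first[of "\<lambda>y. h (?u(Suc 0 := y))"] by simp
next
  case (Suc n)
  note [measurable] = Suc.prems(1)
  let ?m = "Suc n"
  \<comment> \<open>\<open>?E \<tau>\<close> averages \<open>h\<close> over a last reward of type
    \<open>\<tau>\<close>; \<open>?g a\<close> does so for the type that the strategy pulls when the
    first set is \<open>a\<close>. Both are again tests bounded by 1, on histories shorter by
    one.\<close>
  let ?E = "\<lambda>\<tau> x. \<integral>y. h (x(Suc ?m := y)) \<partial>N \<tau>"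
  let ?g = "\<lambda>a x. ?E (pulled_type \<pi> a (Suc ?m) x) x"
  have upd [measurable]: "(\<lambda>(x, y). x(Suc ?m := y)) \<in> histories ?m \<Otimes>\<^sub>M borel \<rightarrow>\<^sub>M histories (Suc ?m)"
    unfolding split_beta by (rule measurable_fun_upd[where J = "{1..?m}"]) auto
  have slice: "(\<lambda>y. h (x(Suc ?m := y))) \<in> borel_measurable borel"
    and slice_bound: "\<bar>h (x(Suc ?m := y))\<bar> \<le> 1" if "x \<in> space (histories ?m)" for x y
  proof -
    have "(\<lambda>y. x(Suc ?m := y)) \<in> borel \<rightarrow>\<^sub>M histories (Suc ?m)"
      by (rule measurable_fun_upd[where J = "{1..?m}"]) (use that in auto)
    then show "(\<lambda>y. h (x(Suc ?m := y))) \<in> borel_measurable borel"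
      by (rule measurable_compose) (rule Suc.prems)
    show "\<bar>h (x(Suc ?m := y))\<bar> \<le> 1"
      using measurable_space[OF upd, of "(x, y)"] that
      by (intro Suc.prems) (simp add: space_pair_measure del: fun_upd_apply)
  qed
  have E_measurable [measurable]: "?E \<tau> \<in> borel_measurable (histories ?m)" for \<tau>
  proof -
    interpret N: sigma_finite_measure "N \<tau>"
      by (intro prob_space_imp_sigma_finite prob_space_N)
    have "(\<lambda>(x, y). h (x(Suc ?m := y))) \<in> borel_measurable (histories ?m \<Otimes>\<^sub>M N \<tau>)"
      using measurable_compose[OF upd Suc.prems(1)]
      by (simp add: split_beta cong: measurable_cong_sets sets_pair_measure_cong)
    then show ?thesis
      by (rule N.borel_measurable_lebesgue_integral)
  qed
  have E_bound: "\<bar>?E \<tau> x\<bar> \<le> 1" if "x \<in> space (histories ?m)" for \<tau> x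
  proof -
    interpret N: prob_space "N \<tau>"
      by (rule prob_space_N)
    have "integrable (N \<tau>) (\<lambda>y. h (x(Suc ?m := y)))"
      using slice slice_bound that
      by (intro N.integrable_const_bound[where B = 1] AE_I2) (auto cong: measurable_cong_sets)
    then have "?E \<tau> x \<le> 1" "?E \<tau> x \<ge> -1"
      using slice_bound[OF that] by (auto intro!: N.integral_le_const N.integral_ge_const simp: abs_le_iff minus_le_iff)
    then show ?thesis by simp
  qed
  have g_measurable: "?g a \<in> borel_measurable (histories ?m)" for a
  proof -
    have "(\<lambda>x. if pulled_type \<pi> a (Suc ?m) x = Inferior then ?E Inferior x else ?E Superior x)
      \<in> borel_measurable (histories ?m)"
      by measurable
    also have "(\<lambda>x. if pulled_type \<pi> a (Suc ?m) x = Inferior then ?E Inferior x else ?E Superior x) = ?g a"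
      by (auto simp: fun_eq_iff) (metis arm_type.exhaust)
    finally show ?thesis .
  qed
  have g_integrable: "integrable (H b ?m) (?g a)" for a b
  proof -
    interpret H: prob_space "H b ?m"
      by (rule prob_space_H)
    show ?thesis
      using g_measurable[of a] E_bound
      by (intro H.integrable_const_bound[where B = 1] AE_I2)
         (auto simp: H_def)
  qed
  interpret S: prob_space "H Superior ?m"
    by (rule prob_space_H)
  \<comment> \<open>Whatever \<open>\<pi>\<close> decides, the two hypotheses pull opposite types,
    so the difference is plus or minus the gap for a single slice of \<open>h\<close>.\<close>
  have "?g Inferior x - ?g Superior x \<le> \<Delta>" if "x \<in> space (histories ?m)" for x
    using gap[OF slice[OF that] slice_bound[OF that]]
    by (cases "\<pi> (Suc ?m) x") (simp_all add: pulled_type_def One_nat_def abs_le_iff)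
  then have "(\<integral>x. ?g Inferior x - ?g Superior x \<partial>H Superior ?m) \<le> \<Delta>"
    by (intro S.integral_le_const Bochner_Integration.integrable_diff g_integrable AE_I2)
       (simp add: H_def)
  then have "(1 - q) * ((\<integral>x. ?g Inferior x \<partial>H Superior ?m) - (\<integral>x. ?g Superior x \<partial>H Superior ?m)) \<le> (1 - q) * \<Delta>"
    using q by (intro mult_left_mono) (simp_all add: g_integrable)
  \<comment> \<open>The induction hypothesis needs one test under both laws:
    \<open>?g Inferior\<close> is taken. Replacing \<open>?g Superior\<close> by it costs an error
    under \<open>H Superior\<close> only, whence the factor \<open>1 - q\<close>.\<close>
  moreover have "q * (\<integral>x. ?g Inferior x \<partial>H Inferior ?m) - (1 - q) * (\<integral>x. ?g Inferior x \<partial>H Superior ?m)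
      \<le> V + real n * ((1 - q) * \<Delta>)"
    by (rule Suc.IH[OF g_measurable E_bound])
  moreover have "(\<integral>x. h x \<partial>H a (Suc ?m)) = (\<integral>x. ?g a x \<partial>H a ?m)" for a
    using Suc.prems by (rule integral_H_Suc)
  ultimately show ?case
    by (simp add: algebra_simps)
qed

section \<open>Averaging over the first set\<close>

lemma integral_reward_mixture:
  assumes p: "0 \<le> p" "p \<le> 1" and int: "\<And>\<tau>. integrable (N \<tau>) (\<lambda>y. y)"
  shows "(\<integral>\<omega>. reward \<pi> (Suc n) \<omega>
            \<partial>(measure_pmf (map_pmf (\<lambda>b. if b then Inferior else Superior) (bernoulli_pmf p)) \<Otimes>\<^sub>M table)) =
         p * (\<integral>\<omega>. reward \<pi> (Suc n) (Inferior, \<omega>) \<partial>table) +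
         (1 - p) * (\<integral>\<omega>. reward \<pi> (Suc n) (Superior, \<omega>) \<partial>table)"
proof -
  let ?P = "map_pmf (\<lambda>b. if b then Inferior else Superior) (bernoulli_pmf p)"
  interpret PT: pair_prob_space "measure_pmf ?P" table
    by unfold_locales
  have reward_eq: "reward \<pi> (Suc n) (a, \<omega>) =
      \<omega> (Suc n, pulled_type \<pi> a (Suc n) (history \<pi> (a, \<omega>) n))" for a \<omega>
    by (simp add: reward_def)
  have [measurable]: "(\<lambda>\<omega>. reward \<pi> (Suc n) (a, \<omega>)) \<in> borel_measurable table" for a
    unfolding reward_def
    by (rule measurable_compose[OF measurable_history_table[of a "Suc n"]]) simp
  \<comment> \<open>The reward is one of the two entries of its row, which gives an integrable
    majorant independent of the strategy.\<close>
  have bound: "\<bar>reward \<pi> (Suc n) (a, \<omega>)\<bar> \<le> \<bar>\<omega> (Suc n, Inferior)\<bar> + \<bar>\<omega> (Suc n, Superior)\<bar>" for a \<omega>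
    unfolding reward_eq by (cases "pulled_type \<pi> a (Suc n) (history \<pi> (a, \<omega>) n)") auto
  have slice: "integrable table (\<lambda>\<omega>. reward \<pi> (Suc n) (a, \<omega>))" for a
    by (rule Bochner_Integration.integrable_bound[of _ "\<lambda>\<omega>. \<bar>\<omega> (Suc n, Inferior)\<bar> + \<bar>\<omega> (Suc n, Superior)\<bar>"])
       (use bound in \<open>auto intro!: integrable_table_component int\<close>)
  \<comment> \<open>Joint measurability follows from that for each fixed first set, as there are
    countably many.\<close>
  have "(\<lambda>z. reward \<pi> (Suc n) (fst z, snd z)) \<in> borel_measurable (count_space UNIV \<Otimes>\<^sub>M table)"
    by (rule measurable_compose_countable'[where I = UNIV and g = fst and f = "\<lambda>a z. reward \<pi> (Suc n) (a, snd z)"])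
       auto
  then have meas: "reward \<pi> (Suc n) \<in> borel_measurable (measure_pmf ?P \<Otimes>\<^sub>M table)"
    by (simp cong: measurable_cong_sets sets_pair_measure_cong)
  have fin: "finite (UNIV :: arm_type set)"
    by (simp add: UNIV_arm_type)
  have "integrable (measure_pmf ?P \<Otimes>\<^sub>M table) (reward \<pi> (Suc n))"
    using meas by (rule PT.Fubini_integrable)
       (auto intro!: slice integrable_measure_pmf_finite finite_subset[OF subset_UNIV fin])
  then have "(\<integral>\<omega>. reward \<pi> (Suc n) \<omega> \<partial>(measure_pmf ?P \<Otimes>\<^sub>M table)) =
      (\<integral>a. (\<integral>\<omega>. reward \<pi> (Suc n) (a, \<omega>) \<partial>table) \<partial>measure_pmf ?P)"
    by (rule PT.integral_fst'[symmetric])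
  also have "\<dots> = (\<integral>b. (\<integral>\<omega>. reward \<pi> (Suc n) (if b then Inferior else Superior, \<omega>) \<partial>table) \<partial>bernoulli_pmf p)"
    by simp
  also have "\<dots> = p * (\<integral>\<omega>. reward \<pi> (Suc n) (Inferior, \<omega>) \<partial>table) +
         (1 - p) * (\<integral>\<omega>. reward \<pi> (Suc n) (Superior, \<omega>) \<partial>table)"
    using p by simp
  finally show ?thesis .
qed

end

section \<open>Distances between densities\<close>

text \<open>The easy half of the duality between the L1 distance and bounded tests: the left side is
  the absolute value of the integral of \<open>(a * f0 - b * f1) * g\<close>.\<close>

lemma density_test_bound:
  fixes f0 f1 g :: "real \<Rightarrow> real"
  assumes f0: "integrable lborel f0" "\<And>x. 0 \<le> f0 x" and f1: "integrable lborel f1" "\<And>x. 0 \<le> f1 x"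
    and g: "g \<in> borel_measurable borel" "\<And>x. \<bar>g x\<bar> \<le> 1"
  shows "\<bar>a * (\<integral>x. g x \<partial>density lborel f0) - b * (\<integral>x. g x \<partial>density lborel f1)\<bar>
         \<le> (\<integral>x. \<bar>a * f0 x - b * f1 x\<bar> \<partial>lborel)"
proof -
  have prod: "integrable lborel (\<lambda>x. f x * g x)" if "integrable lborel f" for f :: "real \<Rightarrow> real"
    using that g
    by (intro Bochner_Integration.integrable_bound[OF that])
       (auto simp: abs_mult intro!: mult_left_le)
  have "a * (\<integral>x. g x \<partial>density lborel f0) - b * (\<integral>x. g x \<partial>density lborel f1) =
      (\<integral>x. (a * f0 x - b * f1 x) * g x \<partial>lborel)"
    using f0 f1 g prod[OF f0(1)] prod[OF f1(1)]
    by (simp add: integral_density left_diff_distrib mult.assoc)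
  also have "\<bar>\<dots>\<bar> \<le> (\<integral>x. \<bar>(a * f0 x - b * f1 x) * g x\<bar> \<partial>lborel)"
    by (rule integral_abs_bound)
  also have "\<dots> \<le> (\<integral>x. \<bar>a * f0 x - b * f1 x\<bar> \<partial>lborel)"
    using f0 f1 g
    by (intro integral_mono integrable_abs prod) (auto simp: abs_mult intro: mult_left_le)
  finally show ?thesis .
qed

text \<open>Dropping the absolute value in the first integral of \<open>G\<close> leaves
  \<open>q - (1 - q)\<close>.\<close>

lemma G_ge: "2 * q - 1 \<le> G q \<mu>"
proof -
  have "2 * q - 1 = (\<integral>x. q * normal_density 0 1 x - (1 - q) * normal_density \<mu> 1 x \<partial>lborel)"
    by simp
  also have "\<dots> \<le> (\<integral>x. \<bar>q * normal_density 0 1 x - (1 - q) * normal_density \<mu> 1 x\<bar> \<partial>lborel)"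
    by (intro integral_mono integrable_abs) auto
  also have "\<dots> \<le> G q \<mu>"
    by (simp add: G_def)
  finally show ?thesis .
qed

lemma G_nonneg: "0 \<le> G q \<mu>"
  by (simp add: G_def le_max_iff_disj)

section \<open>The regret of every strategy on the unit-variance instance\<close>

theorem theorem11:
  fixes q \<mu> \<epsilon> :: real and T :: nat and M :: "mab set"
  assumes "1 / 3 \<le> q" and "q \<le> 1" and "0 < \<mu>"
    and "G q \<mu> < q"
    and "G q \<mu> < \<epsilon>" and "\<epsilon> < q"
    and "real T \<le> (\<epsilon> - G q \<mu>) /
           ((1 - q) * (\<integral>x. \<bar>normal_density 0 1 x - normal_density \<mu> 1 x\<bar> \<partial>lborel)) + 2"
    and "M \<subseteq> {m. gaussian_mab m}" and "unit_gaussian_mab q \<mu> \<in> M"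
  shows "R_L M T \<ge> ereal ((q - \<epsilon>) * \<mu> * real T)"
proof -
  let ?m = "unit_gaussian_mab q \<mu>" and ?c = "\<lambda>\<tau>. case \<tau> of Inferior \<Rightarrow> 0 | Superior \<Rightarrow> \<mu>"
  let ?N = "reward_dist ?m"
  let ?\<Delta> = "\<integral>x. \<bar>normal_density 0 1 x - normal_density \<mu> 1 x\<bar> \<partial>lborel"
  \<comment> \<open>From \<open>2 * q - 1 \<le> G q \<mu> < q\<close>. Superior arms are therefore
    present and the best mean is \<open>\<mu>\<close>.\<close>
  have q: "0 \<le> q" "q < 1"
    using assms(1,2,4) G_ge[of q \<mu>] by auto
  have \<epsilon>: "0 < \<epsilon>" "2 * q - 1 < \<epsilon>"
    using assms(5) G_ge[of q \<mu>] G_nonneg[of q \<mu>] by auto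
  have N: "?N \<tau> = density lborel (normal_density (?c \<tau>) 1)" for \<tau>
    by (simp add: reward_dist_def unit_gaussian_mab_def)
  have N_mean: "(\<integral>y. y \<partial>?N \<tau>) = ?c \<tau>" and N_integrable: "integrable (?N \<tau>) (\<lambda>y. y)" for \<tau>
    unfolding N by (simp_all add: integral_density integrable_density
        integral_normal_moment_nz_1 integrable_normal_moment_nz_1)
  have inferior_prop: "inferior_prop ?m = q"
    by (simp add: unit_gaussian_mab_def)
  have best: "best_mean ?m = \<mu>"
    using q assms(1,3)
    by (simp add: best_mean_def first_set_def unit_gaussian_mab_def image_image UNIV_bool)
  have regret: "(q - \<epsilon>) * \<mu> * real T \<le> pseudo_regret ?m \<pi> T" if "\<pi> \<in> strategies" for \<pi>
  proof -
    interpret two_type_bandit ?N \<pi>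
      using that by (intro two_type_bandit.intro) (simp_all add: N prob_space_normal_density)
    let ?R = "\<lambda>t. \<integral>\<omega>. reward \<pi> t \<omega> \<partial>outcome_space ?m"
    have R: "?R (Suc n) = q * (\<integral>x. ?c (pulled_type \<pi> Inferior (Suc n) x) \<partial>H Inferior n) +
        (1 - q) * (\<integral>x. ?c (pulled_type \<pi> Superior (Suc n) x) \<partial>H Superior n)" for n
      using integral_reward_mixture[of q n] q N_integrable
      by (simp add: integral_reward N_mean outcome_space_def first_set_def inferior_prop)
    \<comment> \<open>The bound holds step by step: each pull has expected shortfall at least
      \<open>(q - \<epsilon>) * \<mu>\<close>.\<close>
    have "?R t \<le> \<mu> - (q - \<epsilon>) * \<mu>" if t: "t \<in> {1..T}" for t
    proof (cases "t = 1")
      case True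
      interpret I: prob_space "H Inferior 0" by (rule prob_space_H)
      interpret S: prob_space "H Superior 0" by (rule prob_space_H)
      \<comment> \<open>The first pull is inferior with probability \<open>q\<close>, so its
        shortfall is \<open>q * \<mu>\<close>.\<close>
      have "?R 1 = (1 - q) * \<mu>"
        using R[of 0] by (simp add: pulled_type_def One_nat_def I.prob_space S.prob_space)
      also have "\<dots> \<le> \<mu> - (q - \<epsilon>) * \<mu>"
        using \<epsilon> assms(3) by (simp add: algebra_simps)
      finally show ?thesis
        using True by simp
    next
      case False
      \<comment> \<open>At step \<open>t\<close> the history holds \<open>t - 1\<close> rewards, of
        which \<open>n\<close> come after the first. This accounts for the \<open>+ 2\<close> in the
        bound on \<open>T\<close>.\<close>
      define n where "n = t - 2"
      have n: "t = Suc (Suc n)"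
        using False t by (auto simp: n_def)
      \<comment> \<open>With the decision coded as a sign, the mean of the pulled arm is
        \<open>\<mu> / 2 * (1 + h x)\<close> if the first set is inferior and
        \<open>\<mu> / 2 * (1 - h x)\<close> if it is superior.\<close>
      define h :: "(nat \<Rightarrow> real) \<Rightarrow> real" where "h x = (if \<pi> t x then -1 else 1)" for x
      have [measurable]: "\<pi> t \<in> histories (Suc n) \<rightarrow>\<^sub>M count_space UNIV"
        unfolding n by (rule measurable_strategy) simp
      have h: "h \<in> borel_measurable (histories (Suc n))"
        unfolding h_def by measurable
      have h_bound: "\<bar>h x\<bar> \<le> 1" for x
        by (simp add: h_def)
      have h_integrable: "integrable (H a (Suc n)) h" for a
      proof -
        interpret H: prob_space "H a (Suc n)" by (rule prob_space_H)
        show ?thesis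
          using h h_bound by (intro H.integrable_const_bound[where B = 1] AE_I2) auto
      qed
      have I: "(\<integral>x. ?c (pulled_type \<pi> Inferior t x) \<partial>H Inferior (Suc n)) = \<mu> / 2 * (1 + (\<integral>x. h x \<partial>H Inferior (Suc n)))"
      proof -
        interpret H: prob_space "H Inferior (Suc n)" by (rule prob_space_H)
        have eq: "?c (pulled_type \<pi> Inferior t x) = \<mu> / 2 * (1 + h x)" for x
          using n by (simp add: pulled_type_def h_def One_nat_def)
        show ?thesis
          unfolding eq by (simp add: h_integrable H.prob_space)
      qed
      have S: "(\<integral>x. ?c (pulled_type \<pi> Superior t x) \<partial>H Superior (Suc n)) = \<mu> / 2 * (1 - (\<integral>x. h x \<partial>H Superior (Suc n)))"
      proof -
        interpret H: prob_space "H Superior (Suc n)" by (rule prob_space_H)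
        have eq: "?c (pulled_type \<pi> Superior t x) = \<mu> / 2 * (1 - h x)" for x
          using n by (simp add: pulled_type_def h_def One_nat_def)
        show ?thesis
          unfolding eq by (simp add: h_integrable H.prob_space)
      qed
      have "q * (\<integral>x. h x \<partial>H Inferior (Suc n)) - (1 - q) * (\<integral>x. h x \<partial>H Superior (Suc n))
          \<le> G q \<mu> + real n * ((1 - q) * ?\<Delta>)"
      proof (rule history_test_bound)
        fix g :: "real \<Rightarrow> real"
        assume g: "g \<in> borel_measurable borel" "\<And>y. \<bar>g y\<bar> \<le> 1"
        note bound = density_test_bound[where ?f0.0 = "normal_density 0 1" and ?f1.0 = "normal_density \<mu> 1",
            OF _ _ _ _ g]
        \<comment> \<open>Weights \<open>q\<close> and \<open>1 - q\<close> give the first integral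
          in \<open>G\<close>; weights 1 and 1 give the plain L1 distance
          \<open>?\<Delta>\<close>.\<close>
        show "q * (\<integral>y. g y \<partial>?N Inferior) - (1 - q) * (\<integral>y. g y \<partial>?N Superior) \<le> G q \<mu>"
          using bound[of q "1 - q"] by (auto simp: N G_def)
        show "\<bar>(\<integral>y. g y \<partial>?N Inferior) - (\<integral>y. g y \<partial>?N Superior)\<bar> \<le> ?\<Delta>"
          using bound[of 1 1] by (auto simp: N)
      qed (use q h h_bound in auto)
      also have "\<dots> \<le> \<epsilon>"
      \<comment> \<open>The split makes division by the increment legitimate without proving
        \<open>?\<Delta>\<close> positive; if the increment vanishes,
        \<open>G q \<mu> < \<epsilon>\<close> suffices.\<close>
      proof (cases "(1 - q) * ?\<Delta> = 0")
        case True
        then show ?thesis using assms(5) by (simp only: mult_zero_right add_0_right less_imp_le)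
      next
        case False
        then have pos: "0 < (1 - q) * ?\<Delta>"
          using q by (simp add: less_le)
        have "real n \<le> (\<epsilon> - G q \<mu>) / ((1 - q) * ?\<Delta>)"
          using assms(7) t n by simp
        then show ?thesis
          using pos by (simp add: pos_le_divide_eq)
      qed
      finally have V: "q * (\<integral>x. h x \<partial>H Inferior (Suc n)) - (1 - q) * (\<integral>x. h x \<partial>H Superior (Suc n)) \<le> \<epsilon>" .
      have "?R t = \<mu> / 2 * (1 + (q * (\<integral>x. h x \<partial>H Inferior (Suc n)) - (1 - q) * (\<integral>x. h x \<partial>H Superior (Suc n))))"
        using R[of "Suc n"] I S unfolding n[symmetric] by (simp add: field_simps)
      \<comment> \<open>By \<open>V\<close> it suffices that
        \<open>1 + \<epsilon> \<le> 2 - 2 * (q - \<epsilon>)\<close>, that is,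
        \<open>2 * q - 1 \<le> \<epsilon>\<close>.\<close>
      also have "\<dots> \<le> \<mu> / 2 * (2 - 2 * (q - \<epsilon>))"
        using V \<epsilon> assms(3) by (intro mult_left_mono) auto
      finally show ?thesis
        by (simp add: field_simps)
    qed
    then have "(\<Sum>t=1..T. ?R t) \<le> real T * (\<mu> - (q - \<epsilon>) * \<mu>)"
      using sum_bounded_above[of "{1..T}" ?R] by simp
    then show ?thesis
      by (simp add: pseudo_regret_def best algebra_simps)
  qed
  show ?thesis
    unfolding R_L_def
  proof (rule INF_greatest)
    fix \<pi> assume "\<pi> \<in> strategies"
    then have "ereal ((q - \<epsilon>) * \<mu> * real T) \<le> ereal (pseudo_regret ?m \<pi> T)"
      using regret by simp
    also have "\<dots> \<le> (SUP m\<in>M. ereal (pseudo_regret m \<pi> T))"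
      by (rule SUP_upper) (rule assms(9))
    finally show "ereal ((q - \<epsilon>) * \<mu> * real T) \<le> (SUP m\<in>M. ereal (pseudo_regret m \<pi> T))" .
  qed
qed

end
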